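(* For all $t\in(0,\pi/2)$, $$\frac{\frac{e(\pi-2)}{\pi}e^{t\cot t-1}+\frac{\sin t}{t}}{2}<\frac{1+\cos t}{2}<\frac{\frac{\sin t}{t}+e^{t\cot t-1}}{2}<\left(e^{-1}+\frac2\pi\right)\frac{1+\cos t}{2}.$$ *)

theory Defs
  imports "HOL-Analysis.Analysis"
begin

end

theory Submission
  imports Defs "HOL-Real_Asymp.Real_Asymp"
begin

text \<open>
  Put \<open>S = sin t / t\<close>, \<open>E = exp (t * cot t - 1)\<close> and \<open>c = cos t\<close>. All three bounds are endpoint
  values of monotone quotients. The derivative of \<open>(1 + c - S) / E\<close> has the sign of
  \<open>-(1 - S) * (S\<^sup>2 + S - (1 + c))\<close>, so this quotient decreases from \<open>1\<close> at \<open>0\<close> to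
  \<open>exp 1 * (1 - 2 / pi)\<close> at \<open>pi / 2\<close>, which gives the first two inequalities. The derivative of
  \<open>(S + E) / (1 + c)\<close> has the sign of \<open>S\<^sup>2 - E\<close>, so this quotient increases up to its value at
  \<open>pi / 2\<close>, which gives the third. The bound \<open>E < S\<^sup>2\<close> holds because \<open>2 * ln S - t * cot t\<close>
  increases from \<open>-1\<close>.
\<close>

section \<open>Taylor bounds for sine and cosine\<close>

lemma sin_ge_taylor7:
  fixes x :: real
  assumes "0 < x"
  shows "x - x ^ 3 / 6 + x ^ 5 / 120 - x ^ 7 / 5040 \<le> sin x"
proof -
  \<comment> \<open>The Lagrange remainder is a phase-shifted sine times
    \<open>x ^ 7 / fact 7\<close>; bounding that sine by -1 produces the last term of the
    claim.\<close>
  obtain y where y: "sin x = (\<Sum>m<7. sin_coeff m * x ^ m) + sin (y + 1/2 * real 7 * pi) / fact 7 * x ^ 7"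
    using Maclaurin_sin_expansion3[of 7 x] assms by auto
  have "-1 \<le> sin (y + 1/2 * real 7 * pi)" by simp
  then have "- (x ^ 7) \<le> sin (y + 1/2 * real 7 * pi) * x ^ 7"
    using mult_right_mono[of "-1" _ "x ^ 7"] assms by fastforce
  moreover have "(\<Sum>m<7. sin_coeff m * x ^ m) = x - x ^ 3 / 6 + x ^ 5 / 120"
    by (simp add: lessThan_nat_numeral sin_coeff_def fact_numeral)
  ultimately show ?thesis
    unfolding y by (simp add: fact_numeral field_simps)
qed

lemma cos_ge_taylor6:
  fixes x :: real
  assumes "0 < x"
  shows "1 - x ^ 2 / 2 + x ^ 4 / 24 - x ^ 6 / 720 \<le> cos x"
proof -
  obtain y where y: "cos x = (\<Sum>m<6. cos_coeff m * x ^ m) + cos (y + 1/2 * real 6 * pi) / fact 6 * x ^ 6"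
    using Maclaurin_cos_expansion2[of x 6] assms by auto
  have "-1 \<le> cos (y + 1/2 * real 6 * pi)" by simp
  then have "- (x ^ 6) \<le> cos (y + 1/2 * real 6 * pi) * x ^ 6"
    using mult_right_mono[of "-1" _ "x ^ 6"] assms by fastforce
  moreover have "(\<Sum>m<6. cos_coeff m * x ^ m) = 1 - x ^ 2 / 2 + x ^ 4 / 24"
    by (simp add: lessThan_nat_numeral cos_coeff_def fact_numeral)
  ultimately show ?thesis
    unfolding y by (simp add: fact_numeral field_simps)
qed

lemma cos_le_taylor4:
  fixes x :: real
  assumes "0 < x"
  shows "cos x \<le> 1 - x ^ 2 / 2 + x ^ 4 / 24"
proof -
  obtain y where y: "cos x = (\<Sum>m<4. cos_coeff m * x ^ m) + cos (y + 1/2 * real 4 * pi) / fact 4 * x ^ 4"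
    using Maclaurin_cos_expansion2[of x 4] assms by auto
  have "cos (y + 1/2 * real 4 * pi) \<le> 1" by simp
  then have "cos (y + 1/2 * real 4 * pi) * x ^ 4 \<le> x ^ 4"
    using mult_right_mono[of _ 1 "x ^ 4"] assms by fastforce
  moreover have "(\<Sum>m<4. cos_coeff m * x ^ m) = 1 - x ^ 2 / 2"
    by (simp add: lessThan_nat_numeral cos_coeff_def fact_numeral)
  ultimately show ?thesis
    unfolding y by (simp add: fact_numeral field_simps)
qed

section \<open>Auxiliary inequalities up to \<open>pi / 2\<close>\<close>

lemma pi_squared_less_10: "pi ^ 2 < 10"
proof -
  have "pi < 3.15" using pi_approx by simp
  then have "pi ^ 2 < 3.15 ^ 2" by (intro power_strict_mono) auto
  then show ?thesis by (simp add: power2_eq_square)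
qed

text \<open>Passing to the limit keeps only a weak inequality; comparing with
  \<open>f (b / 2)\<close> first restores strictness. A one-sided limit is used since
  \<open>sin t / t\<close> and \<open>t * cot t\<close> have the default value 0 at 0, not their
  limit 1.\<close>

lemma greater_limit_at_right_0:
  fixes f :: "real \<Rightarrow> real"
  assumes "(f \<longlongrightarrow> L) (at_right 0)" "0 < b"
    and deriv: "\<And>x. 0 < x \<Longrightarrow> x \<le> b \<Longrightarrow> \<exists>y. (f has_real_derivative y) (at x) \<and> 0 < y"
  shows "L < f b"
proof -
  have mono: "f x < f y" if "0 < x" "x < y" "y \<le> b" for x y
    using that by (intro DERIV_pos_imp_increasing[of x y f] deriv) auto
  have "\<forall>\<^sub>F x in at_right 0. f x \<le> f (b / 2)"
    unfolding eventually_at_right_field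
    using assms(2) mono[of _ "b / 2"] by (intro exI[of _ "b / 2"]) (auto intro: less_imp_le)
  then have "L \<le> f (b / 2)"
    using assms(1) by (intro tendsto_upperbound) auto
  also have "\<dots> < f b" using assms(2) by (intro mono) auto
  finally show ?thesis .
qed

lemma sin_less_x:
  fixes x :: real
  assumes "0 < x" "x \<le> pi / 2"
  shows "sin x < x"
proof -
  have "0 < x - sin x"
  proof (rule greater_limit_at_right_0[where f = "\<lambda>x. x - sin x" and b = x])
    show "((\<lambda>x::real. x - sin x) \<longlongrightarrow> 0) (at_right 0)" by real_asymp
    show "0 < x" by fact
  next
    fix y assume y: "0 < y" "y \<le> x"
    then have "cos y < 1" using cos_monotone_0_pi[of 0 y] assms by simp
    then show "\<exists>d. ((\<lambda>x. x - sin x) has_real_derivative d) (at y) \<and> 0 < d"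
      by (intro exI[of _ "1 - cos y"]) (auto intro!: derivative_eq_intros)
  qed
  then show ?thesis by simp
qed

text \<open>This fixes the sign in \<open>quotient_derivative_pos\<close>. In
  \<open>x = t ^ 2\<close> both sides start with \<open>2 - x / 2\<close>, so the quadratic
  coefficients decide.\<close>

lemma sinc_plus_sinc_squared_gt:
  fixes t :: real
  assumes "0 < t" "t \<le> pi / 2"
  shows "1 + cos t < sin t / t + (sin t / t) ^ 2"
proof -
  define x where "x = t ^ 2"
  have "t ^ 2 \<le> (pi / 2) ^ 2" using assms by (intro power_mono) auto
  then have x: "0 < x" "x < 5 / 2"
    using assms pi_squared_less_10 by (auto simp: x_def power_divide)
  \<comment> \<open>For \<open>x < 5 / 2\<close> one has \<open>1 - x / 42 \<ge> 120 / 128\<close>,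
    so replacing 1/120 by 1/128 absorbs the cubic Taylor term.\<close>
  define p where "p = 1 - x / 6 + x ^ 2 / 128"
  have "x ^ 2 / 120 * (1 - x / 42) \<ge> x ^ 2 / 120 * (120 / 128)"
    using x by (intro mult_left_mono) auto
  then have "p \<le> 1 - x / 6 + x ^ 2 / 120 - x ^ 3 / 5040"
    by (simp add: p_def algebra_simps power2_eq_square power3_eq_cube)
  also have "\<dots> = (t - t ^ 3 / 6 + t ^ 5 / 120 - t ^ 7 / 5040) / t"
    using assms by (simp add: x_def field_simps flip: power_mult power_Suc)
      (simp add: eval_nat_numeral algebra_simps)
  also have "\<dots> \<le> sin t / t"
    using assms sin_ge_taylor7[of t] by (intro divide_right_mono) auto
  finally have ps: "p \<le> sin t / t" .
  have p0: "0 < p" using x by (simp add: p_def add_pos_nonneg)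
  have "1 + cos t \<le> 2 - x / 2 + x ^ 2 / 24"
    using cos_le_taylor4[of t] assms by (simp add: x_def flip: power_mult)
  also have "\<dots> < p + p ^ 2"
  proof -
    \<comment> \<open>Here \<open>3 / 128 + 1 / 36\<close> is the quadratic coefficient of
      \<open>p + p ^ 2\<close>, 1/24 that of the cosine bound, and \<open>x / 384\<close> comes from
      the cubic term of \<open>p ^ 2\<close>.\<close>
    have "0 < x ^ 2 * (3 / 128 + 1 / 36 - 1 / 24 - x / 384)"
      using x by (intro mult_pos_pos) auto
    moreover have "p + p ^ 2 = 2 - x / 2 + x ^ 2 / 24
        + x ^ 2 * (3 / 128 + 1 / 36 - 1 / 24 - x / 384) + x ^ 4 / 16384"
      by (simp add: p_def power2_eq_square power3_eq_cube power4_eq_xxxx field_simps)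
    moreover have "0 < x ^ 4 / 16384" using x by simp
    ultimately show ?thesis by linarith
  qed
  also have "\<dots> \<le> sin t / t + (sin t / t) ^ 2"
    using ps p0 by (intro add_mono power_mono) auto
  finally show ?thesis .
qed

text \<open>The expression is the numerator of the derivative of
  \<open>2 * ln (sin t / t) - t * cot t\<close>. Doubling the angle makes it linear in
  \<open>sin u\<close> and \<open>cos u\<close>; the Taylor terms through \<open>u ^ 4\<close>
  cancel, and the rest is positive for \<open>u ^ 2 < 14\<close>.\<close>

lemma t_sin_cos_bound:
  fixes t :: real
  assumes "0 < t" "t \<le> pi / 2"
  shows "0 < t * sin t * cos t - 2 * sin t ^ 2 + t ^ 2"
proof -
  define u where "u = 2 * t"
  have u: "0 < u" "u \<le> pi" using assms by (auto simp: u_def)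
  have "u ^ 2 \<le> pi ^ 2" using u by (intro power_mono) auto
  then have u2: "u ^ 2 < 10" using pi_squared_less_10 by linarith
  have "0 < u ^ 6 * (1 / 1440 - u ^ 2 / 20160)"
    using u u2 by (intro mult_pos_pos) auto
  also have "\<dots> = u / 4 * (u - u ^ 3 / 6 + u ^ 5 / 120 - u ^ 7 / 5040) - 1
      + (1 - u ^ 2 / 2 + u ^ 4 / 24 - u ^ 6 / 720) + u ^ 2 / 4"
    by (simp add: eval_nat_numeral field_simps)
  also have "\<dots> \<le> u / 4 * sin u - 1 + cos u + u ^ 2 / 4"
    using u sin_ge_taylor7[of u] cos_ge_taylor6[of u]
    by (intro add_mono diff_mono mult_left_mono) auto
  also have "\<dots> = t * sin t * cos t - 2 * sin t ^ 2 + t ^ 2"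
    unfolding u_def sin_double cos_double_sin by (simp add: power2_eq_square algebra_simps)
  finally show ?thesis .
qed

section \<open>Derivatives and their signs\<close>

lemma has_real_derivative_sinc:
  fixes x :: real
  assumes "x \<noteq> 0"
  shows "((\<lambda>t. sin t / t) has_real_derivative (x * cos x - sin x) / x ^ 2) (at x)"
  using assms by (auto intro!: derivative_eq_intros simp: power2_eq_square)

lemma has_real_derivative_t_cot:
  fixes x :: real
  assumes "sin x \<noteq> 0"
  shows "((\<lambda>t. t * cot t) has_real_derivative (sin x * cos x - x) / sin x ^ 2) (at x)"
  using assms by (auto intro!: derivative_eq_intros simp: cot_def field_simps power2_eq_square)
    (simp flip: distrib_left power2_eq_square)

lemma exp_t_cot_less_sinc_squared:
  fixes t :: real
  assumes "0 < t" "t \<le> pi / 2"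
  shows "exp (t * cot t - 1) < (sin t / t) ^ 2"
proof -
  let ?f = "\<lambda>t::real. 2 * ln (sin t / t) - t * cot t"
  have "-1 < ?f t"
  proof (rule greater_limit_at_right_0[where f = ?f and b = t])
    show "(?f \<longlongrightarrow> -1) (at_right 0)" unfolding cot_def by real_asymp
    show "0 < t" by fact
  next
    fix x :: real assume x: "0 < x" "x \<le> t"
    have s: "0 < sin x" using x assms by (intro sin_gt_zero) auto
    have D: "(?f has_real_derivative 2 * (inverse (sin x / x) * ((x * cos x - sin x) / x ^ 2))
        - (sin x * cos x - x) / sin x ^ 2) (at x)"
      using s x by (intro DERIV_diff DERIV_cmult DERIV_chain2[where f = ln] DERIV_ln
          has_real_derivative_sinc has_real_derivative_t_cot) auto
    have eq: "2 * (inverse (sin x / x) * ((x * cos x - sin x) / x ^ 2))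
        - (sin x * cos x - x) / sin x ^ 2
      = (x * sin x * cos x - 2 * sin x ^ 2 + x ^ 2) / (x * sin x ^ 2)"
      using s x by (simp add: field_simps power2_eq_square)
    have "0 < (x * sin x * cos x - 2 * sin x ^ 2 + x ^ 2) / (x * sin x ^ 2)"
      using s x assms t_sin_cos_bound[of x] by (intro divide_pos_pos) auto
    then show "\<exists>y. (?f has_real_derivative y) (at x) \<and> 0 < y"
      using D unfolding eq by blast
  qed
  then have "t * cot t - 1 < 2 * ln (sin t / t)" by (simp add: cot_def)
  then have "exp (t * cot t - 1) < exp (2 * ln (sin t / t))" by simp
  also have "\<dots> = (sin t / t) ^ 2"
    using assms sin_gt_zero[of t] by (simp add: exp_double)
  finally show ?thesis .
qed

text \<open>The function is \<open>- (1 + c - S) / E\<close>, with \<open>1 / E\<close> written as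
  an exponential so that the product rule applies. The range includes \<open>pi / 2\<close>, where
  the endpoint value is taken.\<close>

lemma quotient_derivative_pos:
  fixes x :: real
  assumes "0 < x" "x \<le> pi / 2"
  shows "\<exists>y. ((\<lambda>t. (sin t / t - 1 - cos t) * exp (1 - t * cot t)) has_real_derivative y) (at x) \<and> 0 < y"
proof -
  have s: "0 < sin x" using assms by (intro sin_gt_zero) auto
  let ?S = "sin x / x" and ?E = "exp (1 - x * cot x)"
  let ?d = "((x * cos x - sin x) / x ^ 2 + sin x) * ?E
    + (?S - 1 - cos x) * (?E * (- ((sin x * cos x - x) / sin x ^ 2)))"
  have "((\<lambda>t. (sin t / t - 1 - cos t) * exp (1 - t * cot t)) has_real_derivative ?d) (at x)"
    using s assms
      DERIV_mult[OF DERIV_diff[OF DERIV_diff[OF has_real_derivative_sinc DERIV_const] DERIV_cos]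
        DERIV_fun_exp[OF DERIV_diff[OF DERIV_const has_real_derivative_t_cot]], of x 1 1]
    by (simp add: mult.commute)
  moreover have "0 < ?d"
  proof -
    have "?d * (x ^ 2 * sin x ^ 2) = ?E * (sin x ^ 2 * (x ^ 2 * sin x + x * cos x - sin x)
        - x * (x - sin x * cos x) * (x + x * cos x - sin x))"
    proof -
      \<comment> \<open>Keeping the fractions opaque turns clearing denominators into a polynomial
        identity plus three substitutions.\<close>
      define A B S where "A = (x * cos x - sin x) / x ^ 2" and "B = (sin x * cos x - x) / sin x ^ 2"
        and "S = sin x / x"
      have cleared: "A * x ^ 2 = x * cos x - sin x" "B * sin x ^ 2 = sin x * cos x - x" "S * x = sin x"
        using s assms by (simp_all add: A_def B_def S_def)
      have "((A + sin x) * ?E + (S - 1 - cos x) * (?E * (- B))) * (x ^ 2 * sin x ^ 2)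
          = ?E * ((A * x ^ 2 + sin x * x ^ 2) * sin x ^ 2
            - x * (S * x - x - cos x * x) * (B * sin x ^ 2))"
        by (simp add: power2_eq_square algebra_simps)
      also have "\<dots> = ?E * (sin x ^ 2 * (x ^ 2 * sin x + x * cos x - sin x)
          - x * (x - sin x * cos x) * (x + x * cos x - sin x))"
        unfolding cleared by (simp add: algebra_simps)
      finally show ?thesis unfolding A_def B_def S_def .
    qed
    \<comment> \<open>\<open>sin x ^ 2 + cos x ^ 2\<close> stays unreduced, so this is a pure
      polynomial identity; the next step replaces it by 1 and factors.\<close>
    also have "\<dots> = ?E * (x ^ 2 * sin x * (sin x ^ 2 + cos x ^ 2)
        + x ^ 2 * sin x * (1 + cos x) - sin x ^ 3 - x ^ 3 * (1 + cos x))"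
      by (simp add: power2_eq_square power3_eq_cube algebra_simps
          del: sin_cos_squared_add sin_cos_squared_add2 sin_cos_squared_add3)
    also have "\<dots> = ?E * (x ^ 3 * ((1 - ?S) * (?S + ?S ^ 2 - (1 + cos x))))"
      using s assms by (simp add: field_simps power2_eq_square power3_eq_cube)
    also have "\<dots> > 0"
      using assms sin_less_x[of x] sinc_plus_sinc_squared_gt[of x]
      by (intro mult_pos_pos) auto
    finally show ?thesis by (rule zero_less_mult_pos2) (use s assms in simp)
  qed
  ultimately show ?thesis by blast
qed

section \<open>Endpoint comparisons for the three inequalities\<close>

theorem theorem5:
  fixes t :: real
  assumes "t \<in> {0<..<pi / 2}"
  shows "(exp 1 * (pi - 2) / pi * exp (t * cot t - 1) + sin t / t) / 2 < (1 + cos t) / 2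
       \<and> (1 + cos t) / 2 < (sin t / t + exp (t * cot t - 1)) / 2
       \<and> (sin t / t + exp (t * cot t - 1)) / 2 < (exp (-1) + 2 / pi) * ((1 + cos t) / 2)"
proof (intro conjI)
  have t: "0 < t" "t < pi / 2" using assms by auto
  let ?g = "\<lambda>t::real. (sin t / t - 1 - cos t) * exp (1 - t * cot t)"
  let ?E = "exp (t * cot t - 1)"
  \<comment> \<open>Multiplying a bound on \<open>?g t\<close> by the positive \<open>?E\<close>
    thus gives a bound on \<open>sin t / t - 1 - cos t\<close>.\<close>
  have gE: "?g t * ?E = sin t / t - 1 - cos t"
    by (simp flip: exp_add)
  have "?g t < ?g (pi / 2)"
    using t by (intro DERIV_pos_imp_increasing[where f = ?g] quotient_derivative_pos) auto
  also have "\<dots> = - (exp 1 * (pi - 2) / pi)"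
    by (simp add: cot_def field_simps)
  finally have "?g t * ?E < - (exp 1 * (pi - 2) / pi) * ?E"
    by (intro mult_strict_right_mono) auto
  then show "(exp 1 * (pi - 2) / pi * ?E + sin t / t) / 2 < (1 + cos t) / 2"
    unfolding gE by (intro divide_strict_right_mono) linarith+
  have "((\<lambda>t::real. (sin t / t - 1 - cos t) * exp (1 - t * (cos t / sin t))) \<longlongrightarrow> -1) (at_right 0)"
    by real_asymp
  then have "-1 < ?g t"
    using t by (intro greater_limit_at_right_0[where f = ?g] quotient_derivative_pos) (auto simp: cot_def)
  then have "-1 * ?E < ?g t * ?E"
    by (intro mult_strict_right_mono) auto
  then show "(1 + cos t) / 2 < (sin t / t + ?E) / 2"
    unfolding gE by (intro divide_strict_right_mono) linarith+
  let ?h = "\<lambda>t::real. (sin t / t + exp (t * cot t - 1)) / (1 + cos t)"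
  have "?h t < ?h (pi / 2)"
  proof (rule DERIV_pos_imp_increasing[where f = ?h])
    show "t < pi / 2" by fact
  next
    fix x :: real assume "t \<le> x" "x \<le> pi / 2"
    then have x: "0 < x" "x \<le> pi / 2" using t by auto
    have s: "0 < sin x" using x by (intro sin_gt_zero) auto
    have c: "0 \<le> cos x" using x by (intro cos_ge_zero) auto
    have c1: "0 < 1 - cos x" using cos_monotone_0_pi[of 0 x] x by simp
    let ?F = "exp (x * cot x - 1)"
    let ?d = "(((x * cos x - sin x) / x ^ 2 + ?F * ((sin x * cos x - x) / sin x ^ 2)) * (1 + cos x)
        + (sin x / x + ?F) * sin x) / (1 + cos x) ^ 2"
    have "(?h has_real_derivative ?d) (at x)"
      using s c x
        DERIV_divide[OF DERIV_add[OF has_real_derivative_sinc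
            DERIV_fun_exp[OF DERIV_diff[OF has_real_derivative_t_cot DERIV_const]]]
          DERIV_add[OF DERIV_const DERIV_cos], of x 1 1]
      by (simp add: power2_eq_square)
    moreover have "0 < ?d"
    proof -
      \<comment> \<open>Both this part, after adding \<open>sin x\<close>, and
        \<open>sinc_part\<close> contain the factor \<open>x - sin x\<close>, with opposite signs;
        pulling it out leaves \<open>(sin x / x) ^ 2 - ?F\<close>.\<close>
      have cot_part: "(sin x * cos x - x) / sin x ^ 2 * (1 + cos x) = (sin x * cos x - x) / (1 - cos x)"
      proof -
        have "sin x ^ 2 = (1 - cos x) * (1 + cos x)"
          by (simp add: sin_squared_eq power2_eq_square algebra_simps)
        then show ?thesis using c by simp
      qed
      have sinc_part: "(x * cos x - sin x) / x ^ 2 * (1 + cos x) + sin x / x * sin x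
        = (x - sin x) * (1 + cos x) / x ^ 2"
      proof -
        have pyth: "sin x * sin x = (1 - cos x) * (1 + cos x)"
          using sin_squared_eq[of x] by (simp add: power2_eq_square algebra_simps)
        have "(x * cos x - sin x) / x ^ 2 * (1 + cos x) + sin x / x * sin x
          = ((x * cos x - sin x) * (1 + cos x) + x * (sin x * sin x)) / x ^ 2"
          using x by (simp add: field_simps power2_eq_square)
        also have "\<dots> = (x - sin x) * (1 + cos x) / x ^ 2"
          unfolding pyth by (simp add: algebra_simps)
        finally show ?thesis .
      qed
      have regroup: "(a + f * b) * k + (p + f) * r = (a * k + p * r) + f * (b * k + r)"
        for a b f k p r :: real
        by (simp add: algebra_simps)
      have "((x * cos x - sin x) / x ^ 2 + ?F * ((sin x * cos x - x) / sin x ^ 2)) * (1 + cos x)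
          + (sin x / x + ?F) * sin x
        = ((x * cos x - sin x) / x ^ 2 * (1 + cos x) + sin x / x * sin x)
          + ?F * ((sin x * cos x - x) / sin x ^ 2 * (1 + cos x) + sin x)"
        by (rule regroup)
      also have "\<dots> = (x - sin x) * (1 + cos x) / x ^ 2
          + ?F * ((sin x * cos x - x) / (1 - cos x) + sin x)"
        unfolding cot_part sinc_part ..
      also have "\<dots> = (x - sin x) / (1 - cos x) * ((1 - cos x) * (1 + cos x) / x ^ 2 - ?F)"
        using x c1 by (simp add: field_simps)
      also have "(1 - cos x) * (1 + cos x) / x ^ 2 = (sin x / x) ^ 2"
        by (simp add: sin_squared_eq power_divide power2_eq_square algebra_simps)
      finally have "?d = (x - sin x) / (1 - cos x) * ((sin x / x) ^ 2 - ?F) / (1 + cos x) ^ 2"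
        by simp
      also have "\<dots> > 0"
        using x c c1 sin_less_x[of x] exp_t_cot_less_sinc_squared[of x]
        by (intro divide_pos_pos mult_pos_pos) auto
      finally show ?thesis .
    qed
    ultimately show "\<exists>y. (?h has_real_derivative y) (at x) \<and> 0 < y" by blast
  qed
  \<comment> \<open>At \<open>pi / 2\<close> both \<open>cot\<close> and \<open>cos\<close> vanish,
    so the denominator is 1.\<close>
  also have "\<dots> = exp (-1) + 2 / pi" by (simp add: cot_def)
  finally have "sin t / t + ?E < (exp (-1) + 2 / pi) * (1 + cos t)"
    using cos_gt_zero[of t] t by (simp add: pos_divide_less_eq)
  then show "(sin t / t + ?E) / 2 < (exp (-1) + 2 / pi) * ((1 + cos t) / 2)"
    unfolding times_divide_eq_right by (rule divide_strict_right_mono) simp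
qed

end
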